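(* Let $d\in\mathbb{N}$ and let $Q\in M_d(\mathbb{C})$ be a diagonal strictly positive matrix with eigenspace dimensions $(d_1,\dots,d_n)$. Let $H$ be a Hilbert space, let $\pi:A_u(Q)\to B(H)$ be a $Q$-representation and let $\eta_1,\eta_2\in Z^1(A_u(Q),{}_\pi H_\epsilon)$. Let $c$ be the $2$-cocycle on $A_u(Q)$ determined by $c(x\otimes y)=\langle\eta_1(x^* ),\eta_2(y)\rangle$, $x,y\in A_u(Q)$. Then $$\Delta(c)\in sl(d_1)\oplus\cdots\oplus sl(d_n).$$
   Context: Write $Q_j:=Q_{jj}$, and let $q_1,\dots,q_n$ be the distinct eigenvalues of $Q$, with eigenspaces of dimensions $d_1,\dots,d_n$. $A_u(Q)$ denotes the universal complex unital $^*$-algebra generated by $u_{jk}$ ($j,k=1,\dots,d$) such that, with $u=(u_{jk})$, $\bar u=(u_{jk}^* )_{j,k}$, $u^t=(u_{kj})_{j,k}$, one has $uu^*=I=u^*u$ and $u^tQ\bar uQ^{-1}=I=Q\bar uQ^{-1}u^t$. Its distinguished character is the unital $^*$-homomorphism $\epsilon$ with $\epsilon(u_{jk})=\delta_{jk}$. A representation is a unital $^*$-homomorphism into $B(H)$, $H$ a Hilbert space. A representation $\pi$ is called a $Q$-representation if $\pi(u_{jk})=0$ whenever $Q_j\neq Q_k$ (every finite-dimensional representation of $A_u(Q)$ is a $Q$-representation). $Z^1(A_u(Q),{}_\pi H_\epsilon)$ is the space of linear maps $\eta:A_u(Q)\to H$ with $\eta(xy)=\pi(x)\eta(y)+\eta(x)\epsilon(y)$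 for all $x,y$. Inner products are linear in the second variable. A $2$-cocycle is a linear $c:A_u(Q)\otimes A_u(Q)\to\mathbb{C}$ with $\epsilon(x)c(y\otimes z)-c(xy\otimes z)+c(x\otimes yz)-c(x\otimes y)\epsilon(z)=0$ for all $x,y,z$; the map $c$ in the claim is a $2$-cocycle. The defect map $\Delta$ sends a $2$-cocycle $c$ to the matrix $\Delta(c)\in M_d(\mathbb{C})$ with entries $\Delta(c)_{jk}=A_{jk}-B_{kj}$ if $Q_j=Q_k$ and $\Delta(c)_{jk}=0$ if $Q_j\ne Q_k$, where $$A_{jk}=\sum_{p=1}^d c(u_{pj}^*\otimes u_{pk}),\qquad B_{jk}=\sum_{p=1}^d\frac{Q_j}{Q_p}c(u_{jp}^*\otimes u_{kp}).$$ $sl(d_1)\oplus\cdots\oplus sl(d_n)$ is regarded as the set of block-diagonal matrices $A\in M_d(\mathbb{C})$ ($A_{jk}=0$ if $Q_j\neq Q_k$) with $\sum_{k:\,Q_k=q_l}A_{kk}=0$ for every $l=1,\dots,n$. *)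

theory Defs
  imports "HOL-Analysis.Analysis" "HOL-Algebra.Module"
begin

section \<open>Complex Hilbert spaces\<close>

text \<open>The inner product is linear in the second variable; completeness comes from the
  class \<^class>\<open>banach\<close>.\<close>

class complex_hilbert_space = banach +
  fixes scaleC :: "complex \<Rightarrow> 'a \<Rightarrow> 'a"  (infixr \<open>*\<^sub>C\<close> 75)
    and cinner :: "'a \<Rightarrow> 'a \<Rightarrow> complex"
  assumes scaleR_scaleC: "scaleR r x = complex_of_real r *\<^sub>C x"
    and scaleC_add_right: "a *\<^sub>C (x + y) = a *\<^sub>C x + a *\<^sub>C y"
    and scaleC_add_left: "(a + b) *\<^sub>C x = a *\<^sub>C x + b *\<^sub>C x"
    and scaleC_scaleC: "a *\<^sub>C b *\<^sub>C x = (a * b) *\<^sub>C x"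
    and cinner_commute: "cinner x y = cnj (cinner y x)"
    and cinner_add_right: "cinner x (y + z) = cinner x y + cinner x z"
    and cinner_scaleC_right: "cinner x (a *\<^sub>C y) = a * cinner x y"
    and cinner_self: "cinner x x = complex_of_real ((norm x)\<^sup>2)"

definition bounded_clinear :: "('h::complex_hilbert_space \<Rightarrow> 'h) \<Rightarrow> bool" where
  "bounded_clinear T \<longleftrightarrow> bounded_linear T \<and> (\<forall>a x. T (a *\<^sub>C x) = a *\<^sub>C T x)"

definition is_adjoint :: "('h::complex_hilbert_space \<Rightarrow> 'h) \<Rightarrow> ('h \<Rightarrow> 'h) \<Rightarrow> bool" where
  "is_adjoint S T \<longleftrightarrow> (\<forall>x y. cinner (S x) y = cinner x (T y))"


section \<open>Complex unital star-algebras\<close>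

record 'a star_algebra = "(complex, 'a) module" +
  star :: "'a \<Rightarrow> 'a"

locale star_algebra = Ring.ring A for A (structure) +
  assumes smult_closed: "x \<in> carrier A \<Longrightarrow> a \<odot> x \<in> carrier A"
    and smult_l_distr: "x \<in> carrier A \<Longrightarrow> (a + b) \<odot> x = a \<odot> x \<oplus> b \<odot> x"
    and smult_r_distr:
      "x \<in> carrier A \<Longrightarrow> y \<in> carrier A \<Longrightarrow> a \<odot> (x \<oplus> y) = a \<odot> x \<oplus> a \<odot> y"
    and smult_assoc: "x \<in> carrier A \<Longrightarrow> (a * b) \<odot> x = a \<odot> (b \<odot> x)"
    and smult_one: "x \<in> carrier A \<Longrightarrow> 1 \<odot> x = x"
    and smult_mult_left:
      "x \<in> carrier A \<Longrightarrow> y \<in> carrier A \<Longrightarrow> (a \<odot> x) \<otimes> y = a \<odot> (x \<otimes> y)"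
    and smult_mult_right:
      "x \<in> carrier A \<Longrightarrow> y \<in> carrier A \<Longrightarrow> x \<otimes> (a \<odot> y) = a \<odot> (x \<otimes> y)"
    and star_closed: "x \<in> carrier A \<Longrightarrow> star A x \<in> carrier A"
    and star_star: "x \<in> carrier A \<Longrightarrow> star A (star A x) = x"
    and star_add:
      "x \<in> carrier A \<Longrightarrow> y \<in> carrier A \<Longrightarrow> star A (x \<oplus> y) = star A x \<oplus> star A y"
    and star_smult: "x \<in> carrier A \<Longrightarrow> star A (a \<odot> x) = cnj a \<odot> star A x"
    and star_mult:
      "x \<in> carrier A \<Longrightarrow> y \<in> carrier A \<Longrightarrow> star A (x \<otimes> y) = star A y \<otimes> star A x"

definition star_hom :: "'a star_algebra \<Rightarrow> 'b star_algebra \<Rightarrow> ('a \<Rightarrow> 'b) \<Rightarrow> bool" where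
  "star_hom A B f \<longleftrightarrow> f \<in> ring_hom A B
     \<and> (\<forall>a. \<forall>x\<in>carrier A. f (a \<odot>\<^bsub>A\<^esub> x) = a \<odot>\<^bsub>B\<^esub> f x)
     \<and> (\<forall>x\<in>carrier A. f (star A x) = star B (f x))"

definition complex_star_algebra :: "complex star_algebra" where
  "complex_star_algebra =
     \<lparr>carrier = UNIV, mult = (*), one = 1, zero = 0, add = (+), smult = (*), star = cnj\<rparr>"

definition representation ::
    "'a star_algebra \<Rightarrow> ('a \<Rightarrow> 'h::complex_hilbert_space \<Rightarrow> 'h) \<Rightarrow> bool" where
  "representation A \<pi> \<longleftrightarrow>
     (\<forall>x\<in>carrier A. bounded_clinear (\<pi> x))
     \<and> (\<forall>x\<in>carrier A. \<forall>y\<in>carrier A. \<pi> (x \<oplus>\<^bsub>A\<^esub> y) = (\<lambda>h. \<pi> x h + \<pi> y h))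
     \<and> (\<forall>a. \<forall>x\<in>carrier A. \<pi> (a \<odot>\<^bsub>A\<^esub> x) = (\<lambda>h. a *\<^sub>C \<pi> x h))
     \<and> (\<forall>x\<in>carrier A. \<forall>y\<in>carrier A. \<pi> (x \<otimes>\<^bsub>A\<^esub> y) = \<pi> x \<circ> \<pi> y)
     \<and> \<pi> \<one>\<^bsub>A\<^esub> = id
     \<and> (\<forall>x\<in>carrier A. is_adjoint (\<pi> (star A x)) (\<pi> x))"

definition one_cocycles ::
    "'a star_algebra \<Rightarrow> ('a \<Rightarrow> 'h::complex_hilbert_space \<Rightarrow> 'h) \<Rightarrow> ('a \<Rightarrow> complex) \<Rightarrow> ('a \<Rightarrow> 'h) set"
  where
  "one_cocycles A \<pi> \<epsilon> = {\<eta>.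
     (\<forall>x\<in>carrier A. \<forall>y\<in>carrier A. \<eta> (x \<oplus>\<^bsub>A\<^esub> y) = \<eta> x + \<eta> y)
     \<and> (\<forall>a. \<forall>x\<in>carrier A. \<eta> (a \<odot>\<^bsub>A\<^esub> x) = a *\<^sub>C \<eta> x)
     \<and> (\<forall>x\<in>carrier A. \<forall>y\<in>carrier A. \<eta> (x \<otimes>\<^bsub>A\<^esub> y) = \<pi> x (\<eta> y) + \<epsilon> y *\<^sub>C \<eta> x)}"

text \<open>A linear functional on the algebraic tensor product of \<open>A\<close> with itself is given as the
  corresponding bilinear form: \<open>c x y\<close> is the value at the elementary tensor of \<open>x\<close> and \<open>y\<close>.\<close>

definition bilinear_form :: "'a star_algebra \<Rightarrow> ('a \<Rightarrow> 'a \<Rightarrow> complex) \<Rightarrow> bool" where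
  "bilinear_form A c \<longleftrightarrow>
     (\<forall>x\<in>carrier A. \<forall>y\<in>carrier A. \<forall>z\<in>carrier A.
        c (x \<oplus>\<^bsub>A\<^esub> y) z = c x z + c y z \<and> c x (y \<oplus>\<^bsub>A\<^esub> z) = c x y + c x z)
     \<and> (\<forall>a. \<forall>x\<in>carrier A. \<forall>y\<in>carrier A.
        c (a \<odot>\<^bsub>A\<^esub> x) y = a * c x y \<and> c x (a \<odot>\<^bsub>A\<^esub> y) = a * c x y)"

definition two_cocycle ::
    "'a star_algebra \<Rightarrow> ('a \<Rightarrow> complex) \<Rightarrow> ('a \<Rightarrow> 'a \<Rightarrow> complex) \<Rightarrow> bool" where
  "two_cocycle A \<epsilon> c \<longleftrightarrow> bilinear_form A c
     \<and> (\<forall>x\<in>carrier A. \<forall>y\<in>carrier A. \<forall>z\<in>carrier A.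
          \<epsilon> x * c y z - c (x \<otimes>\<^bsub>A\<^esub> y) z + c x (y \<otimes>\<^bsub>A\<^esub> z) - c x y * \<epsilon> z = 0)"


section \<open>Matrices over a star-algebra and the defining relations\<close>

definition amat_mult :: "'a star_algebra \<Rightarrow> ('d::finite \<Rightarrow> 'd \<Rightarrow> 'a) \<Rightarrow> ('d \<Rightarrow> 'd \<Rightarrow> 'a) \<Rightarrow> 'd \<Rightarrow> 'd \<Rightarrow> 'a"
  where "amat_mult A X Y = (\<lambda>j k. \<Oplus>\<^bsub>A\<^esub>p\<in>UNIV. X j p \<otimes>\<^bsub>A\<^esub> Y p k)"

definition amat_of :: "'a star_algebra \<Rightarrow> complex ^ 'd ^ 'd \<Rightarrow> 'd \<Rightarrow> 'd \<Rightarrow> 'a" where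
  "amat_of A M = (\<lambda>j k. (M $ j $ k) \<odot>\<^bsub>A\<^esub> \<one>\<^bsub>A\<^esub>)"

definition amat_one :: "'a star_algebra \<Rightarrow> 'd \<Rightarrow> 'd \<Rightarrow> 'a" where
  "amat_one A = (\<lambda>j k. if j = k then \<one>\<^bsub>A\<^esub> else \<zero>\<^bsub>A\<^esub>)"

definition amat_transpose :: "('d \<Rightarrow> 'd \<Rightarrow> 'a) \<Rightarrow> 'd \<Rightarrow> 'd \<Rightarrow> 'a" where
  "amat_transpose X = (\<lambda>j k. X k j)"

definition amat_bar :: "'a star_algebra \<Rightarrow> ('d \<Rightarrow> 'd \<Rightarrow> 'a) \<Rightarrow> 'd \<Rightarrow> 'd \<Rightarrow> 'a" where
  "amat_bar A X = (\<lambda>j k. star A (X j k))"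

definition amat_adjoint :: "'a star_algebra \<Rightarrow> ('d \<Rightarrow> 'd \<Rightarrow> 'a) \<Rightarrow> 'd \<Rightarrow> 'd \<Rightarrow> 'a" where
  "amat_adjoint A X = amat_transpose (amat_bar A X)"

definition au_relations :: "complex ^ 'd ^ 'd::finite \<Rightarrow> 'a star_algebra \<Rightarrow> ('d \<Rightarrow> 'd \<Rightarrow> 'a) \<Rightarrow> bool"
  where
  "au_relations Q A u \<longleftrightarrow>
     amat_mult A u (amat_adjoint A u) = amat_one A
     \<and> amat_mult A (amat_adjoint A u) u = amat_one A
     \<and> amat_mult A (amat_mult A (amat_mult A (amat_transpose u) (amat_of A Q)) (amat_bar A u))
         (amat_of A (matrix_inv Q)) = amat_one A
     \<and> amat_mult A (amat_mult A (amat_mult A (amat_of A Q) (amat_bar A u)) (amat_of A (matrix_inv Q)))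
         (amat_transpose u) = amat_one A"


section \<open>The universal star-algebra\<close>

text \<open>The universal algebra is built as formal star-polynomials in the generators modulo
  the least congruence that contains the axioms of a complex unital star-algebra and the
  defining relations. That it satisfies the relations and has the universal property is shown
  in \<open>au_relations_A_u\<close>, \<open>A_u_universal\<close> and \<open>A_u_hom_unique\<close> below.\<close>

datatype 'd au_term =
    TGen 'd 'd
  | TZero
  | TOne
  | TAdd "'d au_term" "'d au_term"
  | TMult "'d au_term" "'d au_term"
  | TScale complex "'d au_term"
  | TStar "'d au_term"

text \<open>The order of summation is irrelevant modulo the congruence, so any enumeration of the
  index type will do.\<close>

definition index_list :: "'d::finite list" where
  "index_list = (SOME xs. distinct xs \<and> set xs = UNIV)"

definition tmat_mult :: "('d::finite \<Rightarrow> 'd \<Rightarrow> 'd au_term) \<Rightarrow> ('d \<Rightarrow> 'd \<Rightarrow> 'd au_term) \<Rightarrow> 'd \<Rightarrow> 'd \<Rightarrow> 'd au_term"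
  where
  "tmat_mult X Y = (\<lambda>j k. foldr (\<lambda>p s. TAdd (TMult (X j p) (Y p k)) s) index_list TZero)"

definition tmat_of :: "complex ^ 'd ^ 'd \<Rightarrow> 'd \<Rightarrow> 'd \<Rightarrow> 'd au_term" where
  "tmat_of M = (\<lambda>j k. TScale (M $ j $ k) TOne)"

definition tmat_one :: "'d \<Rightarrow> 'd \<Rightarrow> 'd au_term" where
  "tmat_one = (\<lambda>j k. if j = k then TOne else TZero)"

inductive au_eq :: "complex ^ 'd ^ 'd::finite \<Rightarrow> 'd au_term \<Rightarrow> 'd au_term \<Rightarrow> bool"
  for Q :: "complex ^ 'd ^ 'd::finite" where
  refl: "au_eq Q s s"
| sym: "au_eq Q s t \<Longrightarrow> au_eq Q t s"
| trans: "au_eq Q r s \<Longrightarrow> au_eq Q s t \<Longrightarrow> au_eq Q r t"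
| add_cong: "au_eq Q s s' \<Longrightarrow> au_eq Q t t' \<Longrightarrow> au_eq Q (TAdd s t) (TAdd s' t')"
| mult_cong: "au_eq Q s s' \<Longrightarrow> au_eq Q t t' \<Longrightarrow> au_eq Q (TMult s t) (TMult s' t')"
| scale_cong: "au_eq Q s s' \<Longrightarrow> au_eq Q (TScale a s) (TScale a s')"
| star_cong: "au_eq Q s s' \<Longrightarrow> au_eq Q (TStar s) (TStar s')"
| add_assoc: "au_eq Q (TAdd (TAdd r s) t) (TAdd r (TAdd s t))"
| add_comm: "au_eq Q (TAdd s t) (TAdd t s)"
| add_zero: "au_eq Q (TAdd TZero t) t"
| add_neg: "au_eq Q (TAdd (TScale (-1) t) t) TZero"
| mult_assoc: "au_eq Q (TMult (TMult r s) t) (TMult r (TMult s t))"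
| mult_one_left: "au_eq Q (TMult TOne t) t"
| mult_one_right: "au_eq Q (TMult t TOne) t"
| distrib_left: "au_eq Q (TMult r (TAdd s t)) (TAdd (TMult r s) (TMult r t))"
| distrib_right: "au_eq Q (TMult (TAdd r s) t) (TAdd (TMult r t) (TMult s t))"
| scale_add_left: "au_eq Q (TScale (a + b) t) (TAdd (TScale a t) (TScale b t))"
| scale_add_right: "au_eq Q (TScale a (TAdd s t)) (TAdd (TScale a s) (TScale a t))"
| scale_assoc: "au_eq Q (TScale (a * b) t) (TScale a (TScale b t))"
| scale_one: "au_eq Q (TScale 1 t) t"
| scale_mult_left: "au_eq Q (TMult (TScale a s) t) (TScale a (TMult s t))"
| scale_mult_right: "au_eq Q (TMult s (TScale a t)) (TScale a (TMult s t))"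
| star_star: "au_eq Q (TStar (TStar t)) t"
| star_add: "au_eq Q (TStar (TAdd s t)) (TAdd (TStar s) (TStar t))"
| star_scale: "au_eq Q (TStar (TScale a t)) (TScale (cnj a) (TStar t))"
| star_mult: "au_eq Q (TStar (TMult s t)) (TMult (TStar t) (TStar s))"
| rel_uustar: "au_eq Q (tmat_mult TGen (\<lambda>j k. TStar (TGen k j)) j k) (tmat_one j k)"
| rel_ustaru: "au_eq Q (tmat_mult (\<lambda>j k. TStar (TGen k j)) TGen j k) (tmat_one j k)"
| rel_utQubarQinv:
    "au_eq Q (tmat_mult (tmat_mult (tmat_mult (\<lambda>j k. TGen k j) (tmat_of Q))
        (\<lambda>j k. TStar (TGen j k))) (tmat_of (matrix_inv Q)) j k) (tmat_one j k)"
| rel_QubarQinvut: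
    "au_eq Q (tmat_mult (tmat_mult (tmat_mult (tmat_of Q) (\<lambda>j k. TStar (TGen j k)))
        (tmat_of (matrix_inv Q))) (\<lambda>j k. TGen k j) j k) (tmat_one j k)"

definition au_class :: "complex ^ 'd ^ 'd::finite \<Rightarrow> 'd au_term \<Rightarrow> 'd au_term set" where
  "au_class Q t = {s. au_eq Q t s}"

definition A_u :: "complex ^ 'd ^ 'd::finite \<Rightarrow> 'd au_term set star_algebra" where
  "A_u Q = \<lparr>carrier = range (au_class Q),
     mult = (\<lambda>X Y. \<Union>s\<in>X. \<Union>t\<in>Y. au_class Q (TMult s t)),
     one = au_class Q TOne,
     zero = au_class Q TZero,
     add = (\<lambda>X Y. \<Union>s\<in>X. \<Union>t\<in>Y. au_class Q (TAdd s t)),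
     smult = (\<lambda>a X. \<Union>s\<in>X. au_class Q (TScale a s)),
     star = (\<lambda>X. \<Union>s\<in>X. au_class Q (TStar s))\<rparr>"

definition au_gen :: "complex ^ 'd ^ 'd::finite \<Rightarrow> 'd \<Rightarrow> 'd \<Rightarrow> 'd au_term set" where
  "au_gen Q j k = au_class Q (TGen j k)"


section \<open>The distinguished character, Q-representations and the defect map\<close>

definition distinguished_character ::
    "complex ^ 'd ^ 'd::finite \<Rightarrow> ('d au_term set \<Rightarrow> complex) \<Rightarrow> bool" where
  "distinguished_character Q \<epsilon> \<longleftrightarrow> star_hom (A_u Q) complex_star_algebra \<epsilon>
     \<and> (\<forall>j k. \<epsilon> (au_gen Q j k) = (if j = k then 1 else 0))"

definition Q_representation ::
    "complex ^ 'd ^ 'd::finite \<Rightarrow> ('d au_term set \<Rightarrow> 'h::complex_hilbert_space \<Rightarrow> 'h) \<Rightarrow> bool" where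
  "Q_representation Q \<pi> \<longleftrightarrow> representation (A_u Q) \<pi>
     \<and> (\<forall>j k. Q $ j $ j \<noteq> Q $ k $ k \<longrightarrow> \<pi> (au_gen Q j k) = (\<lambda>_. 0))"

definition diagonal_matrix :: "complex ^ 'd ^ 'd \<Rightarrow> bool" where
  "diagonal_matrix Q \<longleftrightarrow> (\<forall>j k. j \<noteq> k \<longrightarrow> Q $ j $ k = 0)"

definition strictly_positive :: "complex ^ 'd ^ 'd::finite \<Rightarrow> bool" where
  "strictly_positive Q \<longleftrightarrow>
     (\<forall>v. v \<noteq> 0 \<longrightarrow> (\<exists>r>0. (\<Sum>j\<in>UNIV. cnj (v $ j) * (Q *v v) $ j) = complex_of_real r))"

definition eigenvalues :: "complex ^ 'd ^ 'd::finite \<Rightarrow> complex set" where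
  "eigenvalues Q = {q. \<exists>v. v \<noteq> 0 \<and> Q *v v = q *s v}"

definition defect_A ::
    "complex ^ 'd ^ 'd::finite \<Rightarrow> ('d au_term set \<Rightarrow> 'd au_term set \<Rightarrow> complex) \<Rightarrow> 'd \<Rightarrow> 'd \<Rightarrow> complex"
  where
  "defect_A Q c j k = (\<Sum>p\<in>UNIV. c (star (A_u Q) (au_gen Q p j)) (au_gen Q p k))"

definition defect_B ::
    "complex ^ 'd ^ 'd::finite \<Rightarrow> ('d au_term set \<Rightarrow> 'd au_term set \<Rightarrow> complex) \<Rightarrow> 'd \<Rightarrow> 'd \<Rightarrow> complex"
  where
  "defect_B Q c j k =
     (\<Sum>p\<in>UNIV. (Q $ j $ j / Q $ p $ p) * c (star (A_u Q) (au_gen Q j p)) (au_gen Q k p))"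

definition defect ::
    "complex ^ 'd ^ 'd::finite \<Rightarrow> ('d au_term set \<Rightarrow> 'd au_term set \<Rightarrow> complex) \<Rightarrow> complex ^ 'd ^ 'd"
  where
  "defect Q c =
     (\<chi> j k. if Q $ j $ j = Q $ k $ k then defect_A Q c j k - defect_B Q c k j else 0)"

text \<open>The direct sum of the \<open>sl(d\<^sub>l)\<close>, one summand for each distinct eigenvalue of \<open>Q\<close>.\<close>

definition sl_direct_sum :: "complex ^ 'd ^ 'd::finite \<Rightarrow> (complex ^ 'd ^ 'd) set" where
  "sl_direct_sum Q = {M.
     (\<forall>j k. Q $ j $ j \<noteq> Q $ k $ k \<longrightarrow> M $ j $ k = 0)
     \<and> (\<forall>q\<in>eigenvalues Q. (\<Sum>k\<in>{k. Q $ k $ k = q}. M $ k $ k) = 0)}"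


section \<open>Basic facts: the construction has the intended properties\<close>

lemma mem_au_class: "t \<in> au_class Q s \<longleftrightarrow> au_eq Q s t"
  by (simp add: au_class_def)

lemma au_class_eq_iff: "au_class Q s = au_class Q t \<longleftrightarrow> au_eq Q s t"
  by (auto simp: au_class_def set_eq_iff intro: au_eq.refl au_eq.sym au_eq.trans)

lemma au_class_closed: "au_class Q t \<in> carrier (A_u Q)"
  by (simp add: A_u_def)

lemma A_u_cases:
  assumes "X \<in> carrier (A_u Q)"
  obtains t where "X = au_class Q t"
  using assms by (auto simp: A_u_def)

lemma UN_const_au: "t \<in> X \<Longrightarrow> (\<And>s. s \<in> X \<Longrightarrow> f s = B) \<Longrightarrow> (\<Union>s\<in>X. f s) = B"
  by blast

lemma A_u_add: "au_class Q s \<oplus>\<^bsub>A_u Q\<^esub> au_class Q t = au_class Q (TAdd s t)"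
proof -
  have "(\<Union>s'\<in>au_class Q s. \<Union>t'\<in>au_class Q t. au_class Q (TAdd s' t')) = au_class Q (TAdd s t)"
    by (intro UN_const_au[of s] UN_const_au[of t])
      (auto simp: mem_au_class au_class_eq_iff intro: au_eq.refl au_eq.add_cong au_eq.sym)
  then show ?thesis by (simp add: A_u_def)
qed

lemma A_u_mult: "au_class Q s \<otimes>\<^bsub>A_u Q\<^esub> au_class Q t = au_class Q (TMult s t)"
proof -
  have "(\<Union>s'\<in>au_class Q s. \<Union>t'\<in>au_class Q t. au_class Q (TMult s' t')) = au_class Q (TMult s t)"
    by (intro UN_const_au[of s] UN_const_au[of t])
      (auto simp: mem_au_class au_class_eq_iff intro: au_eq.refl au_eq.mult_cong au_eq.sym)
  then show ?thesis by (simp add: A_u_def)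
qed

lemma A_u_smult: "a \<odot>\<^bsub>A_u Q\<^esub> au_class Q t = au_class Q (TScale a t)"
proof -
  have "(\<Union>t'\<in>au_class Q t. au_class Q (TScale a t')) = au_class Q (TScale a t)"
    by (rule UN_const_au[of t])
      (auto simp: mem_au_class au_class_eq_iff intro: au_eq.refl au_eq.scale_cong au_eq.sym)
  then show ?thesis by (simp add: A_u_def)
qed

lemma A_u_star: "star (A_u Q) (au_class Q t) = au_class Q (TStar t)"
proof -
  have "(\<Union>t'\<in>au_class Q t. au_class Q (TStar t')) = au_class Q (TStar t)"
    by (rule UN_const_au[of t])
      (auto simp: mem_au_class au_class_eq_iff intro: au_eq.refl au_eq.star_cong au_eq.sym)
  then show ?thesis by (simp add: A_u_def)
qed

lemma A_u_zero: "\<zero>\<^bsub>A_u Q\<^esub> = au_class Q TZero"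
  and A_u_one: "\<one>\<^bsub>A_u Q\<^esub> = au_class Q TOne"
  by (simp_all add: A_u_def)

lemmas A_u_ops = A_u_add A_u_mult A_u_smult A_u_star A_u_zero A_u_one

lemma au_gen_closed: "au_gen Q j k \<in> carrier (A_u Q)"
  by (simp add: au_gen_def au_class_closed)

lemma ring_A_u: "Ring.ring (A_u Q)"
proof (rule ringI)
  show "abelian_group (A_u Q)"
  proof (rule abelian_groupI)
    fix x assume "x \<in> carrier (A_u Q)"
    then obtain t where t: "x = au_class Q t" by (rule A_u_cases)
    show "\<exists>y\<in>carrier (A_u Q). y \<oplus>\<^bsub>A_u Q\<^esub> x = \<zero>\<^bsub>A_u Q\<^esub>"
      by (rule bexI[of _ "au_class Q (TScale (-1) t)"])
        (simp_all add: t A_u_ops au_class_closed au_class_eq_iff au_eq.add_neg)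
  qed (auto elim!: A_u_cases del: equalityI simp: A_u_ops au_class_closed au_class_eq_iff
        intro: au_eq.add_assoc au_eq.add_comm au_eq.add_zero)
  show "Group.monoid (A_u Q)"
    by (rule monoidI) (auto elim!: A_u_cases del: equalityI simp: A_u_ops au_class_closed au_class_eq_iff
        intro: au_eq.mult_assoc au_eq.mult_one_left au_eq.mult_one_right)
qed (auto elim!: A_u_cases del: equalityI simp: A_u_ops au_class_closed au_class_eq_iff
      intro: au_eq.distrib_left au_eq.distrib_right)

lemma star_algebra_A_u: "star_algebra (A_u Q)"
proof -
  interpret Ring.ring "A_u Q" by (rule ring_A_u)
  show ?thesis
    by unfold_locales (auto elim!: A_u_cases del: equalityI simp: A_u_ops au_class_closed au_class_eq_iff
        intro: au_eq.scale_add_left au_eq.scale_add_right au_eq.scale_assoc au_eq.scale_one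
          au_eq.scale_mult_left au_eq.scale_mult_right au_eq.star_star au_eq.star_add
          au_eq.star_scale au_eq.star_mult)
qed

lemma index_list: "distinct (index_list :: 'd::finite list)" "set (index_list :: 'd list) = UNIV"
proof -
  have "\<exists>xs::'d list. distinct xs \<and> set xs = UNIV"
    using finite_distinct_list[of "UNIV :: 'd set"] by auto
  from someI_ex[OF this] show "distinct (index_list :: 'd list)" "set (index_list :: 'd list) = UNIV"
    unfolding index_list_def by auto
qed

lemma foldr_add_eq_finsum:
  assumes "abelian_group B" "\<And>p. f p \<in> carrier B"
  shows "foldr (\<lambda>p s. f p \<oplus>\<^bsub>B\<^esub> s) (index_list :: 'd::finite list) \<zero>\<^bsub>B\<^esub>
    = (\<Oplus>\<^bsub>B\<^esub>p\<in>(UNIV :: 'd set). f p)"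
proof -
  interpret abelian_group B by fact
  have "distinct xs \<Longrightarrow> foldr (\<lambda>p s. f p \<oplus>\<^bsub>B\<^esub> s) xs \<zero>\<^bsub>B\<^esub> = (\<Oplus>\<^bsub>B\<^esub>p\<in>set xs. f p)" for xs
    by (induction xs) (auto simp: assms(2))
  from this[OF index_list(1)] show ?thesis by (simp add: index_list(2))
qed

lemma tmat_mult_class:
  "(\<lambda>j k. au_class Q (tmat_mult X Y j k))
     = amat_mult (A_u Q) (\<lambda>j k. au_class Q (X j k)) (\<lambda>j k. au_class Q (Y j k))"
proof (intro ext)
  fix j k
  interpret star_algebra "A_u Q" by (rule star_algebra_A_u)
  have "au_class Q (foldr (\<lambda>p s. TAdd (TMult (X j p) (Y p k)) s) xs TZero)
    = foldr (\<lambda>p s. (au_class Q (X j p) \<otimes>\<^bsub>A_u Q\<^esub> au_class Q (Y p k)) \<oplus>\<^bsub>A_u Q\<^esub> s) xs \<zero>\<^bsub>A_u Q\<^esub>" for xs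
  proof (induction xs)
    case Nil
    show ?case by (simp add: A_u_ops)
  next
    case (Cons p xs)
    from Cons.IH[symmetric] show ?case by (simp add: A_u_ops)
  qed
  then show "au_class Q (tmat_mult X Y j k)
    = amat_mult (A_u Q) (\<lambda>j k. au_class Q (X j k)) (\<lambda>j k. au_class Q (Y j k)) j k"
    unfolding tmat_mult_def amat_mult_def
    by (simp add: foldr_add_eq_finsum[OF is_abelian_group] au_class_closed)
qed

lemma tmat_of_class: "(\<lambda>j k. au_class Q (tmat_of M j k)) = amat_of (A_u Q) M"
  by (simp add: tmat_of_def amat_of_def A_u_ops)

lemma tmat_one_class: "(\<lambda>j k. au_class Q (tmat_one j k)) = amat_one (A_u Q)"
  by (auto simp: tmat_one_def amat_one_def A_u_ops fun_eq_iff)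

lemma au_relations_A_u: "au_relations Q (A_u Q) (au_gen Q)"
proof -
  let ?u = "\<lambda>j k. au_class Q (TGen j k)"
  have u: "au_gen Q = ?u" by (simp add: au_gen_def fun_eq_iff)
  have bar: "amat_bar (A_u Q) ?u = (\<lambda>j k. au_class Q (TStar (TGen j k)))"
    by (simp add: amat_bar_def A_u_ops)
  have adj: "amat_adjoint (A_u Q) ?u = (\<lambda>j k. au_class Q (TStar (TGen k j)))"
    by (simp add: amat_adjoint_def amat_transpose_def bar)
  have tr: "amat_transpose ?u = (\<lambda>j k. au_class Q (TGen k j))"
    by (simp add: amat_transpose_def)
  show ?thesis
    unfolding au_relations_def u bar adj tr
    unfolding tmat_of_class[symmetric] tmat_one_class[symmetric] tmat_mult_class[symmetric]
    by (auto simp: fun_eq_iff au_class_eq_iff intro: au_eq.rel_uustar au_eq.rel_ustaru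
        au_eq.rel_utQubarQinv au_eq.rel_QubarQinvut)
qed

primrec au_term_eval :: "'b star_algebra \<Rightarrow> ('d \<Rightarrow> 'd \<Rightarrow> 'b) \<Rightarrow> 'd au_term \<Rightarrow> 'b" where
  "au_term_eval B v (TGen j k) = v j k"
| "au_term_eval B v TZero = \<zero>\<^bsub>B\<^esub>"
| "au_term_eval B v TOne = \<one>\<^bsub>B\<^esub>"
| "au_term_eval B v (TAdd s t) = au_term_eval B v s \<oplus>\<^bsub>B\<^esub> au_term_eval B v t"
| "au_term_eval B v (TMult s t) = au_term_eval B v s \<otimes>\<^bsub>B\<^esub> au_term_eval B v t"
| "au_term_eval B v (TScale a t) = a \<odot>\<^bsub>B\<^esub> au_term_eval B v t"
| "au_term_eval B v (TStar t) = star B (au_term_eval B v t)"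

lemma au_term_eval_closed:
  assumes "star_algebra B" "\<And>j k. v j k \<in> carrier B"
  shows "au_term_eval B v t \<in> carrier B"
proof -
  interpret star_algebra B by fact
  show ?thesis by (induction t) (auto simp: assms(2) smult_closed star_closed)
qed

lemma au_term_eval_tmat_mult:
  assumes "star_algebra B" "\<And>j k. v j k \<in> carrier B"
  shows "(\<lambda>j k. au_term_eval B v (tmat_mult X Y j k))
    = amat_mult B (\<lambda>j k. au_term_eval B v (X j k)) (\<lambda>j k. au_term_eval B v (Y j k))"
proof (intro ext)
  fix j k
  interpret star_algebra B by fact
  note closed = au_term_eval_closed[OF assms]
  have "au_term_eval B v (foldr (\<lambda>p s. TAdd (TMult (X j p) (Y p k)) s) xs TZero)
    = foldr (\<lambda>p s. (au_term_eval B v (X j p) \<otimes>\<^bsub>B\<^esub> au_term_eval B v (Y p k)) \<oplus>\<^bsub>B\<^esub> s) xs \<zero>\<^bsub>B\<^esub>" for xs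
    by (induction xs) simp_all
  then show "au_term_eval B v (tmat_mult X Y j k)
    = amat_mult B (\<lambda>j k. au_term_eval B v (X j k)) (\<lambda>j k. au_term_eval B v (Y j k)) j k"
    unfolding tmat_mult_def amat_mult_def
    by (simp add: foldr_add_eq_finsum[OF is_abelian_group] closed)
qed

lemma au_term_eval_cong:
  assumes B: "star_algebra B" and v: "\<And>j k. v j k \<in> carrier B" and rel: "au_relations Q B v"
    and eq: "au_eq Q s t"
  shows "au_term_eval B v s = au_term_eval B v t"
proof -
  interpret star_algebra B by fact
  note closed = au_term_eval_closed[OF B v]
  let ?e = "\<lambda>X j k. au_term_eval B v (X j k)"
  note mult = au_term_eval_tmat_mult[OF B v]
  have one: "?e tmat_one = amat_one B"
    by (auto simp: tmat_one_def amat_one_def fun_eq_iff)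
  have of: "?e (tmat_of M) = amat_of B M" for M
    by (simp add: tmat_of_def amat_of_def)
  have gen: "?e TGen = v" by simp
  have tr: "?e (\<lambda>j k. TGen k j) = amat_transpose v" by (simp add: amat_transpose_def)
  have bar: "?e (\<lambda>j k. TStar (TGen j k)) = amat_bar B v" by (simp add: amat_bar_def)
  have adj: "?e (\<lambda>j k. TStar (TGen k j)) = amat_adjoint B v"
    by (simp add: amat_adjoint_def amat_transpose_def amat_bar_def)
  have rels:
    "?e (tmat_mult TGen (\<lambda>j k. TStar (TGen k j))) = ?e tmat_one"
    "?e (tmat_mult (\<lambda>j k. TStar (TGen k j)) TGen) = ?e tmat_one"
    "?e (tmat_mult (tmat_mult (tmat_mult (\<lambda>j k. TGen k j) (tmat_of Q))
        (\<lambda>j k. TStar (TGen j k))) (tmat_of (matrix_inv Q))) = ?e tmat_one"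
    "?e (tmat_mult (tmat_mult (tmat_mult (tmat_of Q) (\<lambda>j k. TStar (TGen j k)))
        (tmat_of (matrix_inv Q))) (\<lambda>j k. TGen k j)) = ?e tmat_one"
    using rel unfolding au_relations_def mult one of gen tr bar adj by blast+
  from eq show ?thesis
  proof (induction rule: au_eq.induct)
    case (add_neg t)
    have "(-1) \<odot>\<^bsub>B\<^esub> x \<oplus>\<^bsub>B\<^esub> x = \<zero>\<^bsub>B\<^esub>" if x: "x \<in> carrier B" for x
    proof -
      have z: "0 \<odot>\<^bsub>B\<^esub> x \<oplus>\<^bsub>B\<^esub> 0 \<odot>\<^bsub>B\<^esub> x = 0 \<odot>\<^bsub>B\<^esub> x"
        using smult_l_distr[OF x, of 0 0] by simp
      have "0 \<odot>\<^bsub>B\<^esub> x = \<zero>\<^bsub>B\<^esub>"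
        using z smult_closed[OF x, of 0] by (metis add.l_cancel_one)
      then show ?thesis using smult_l_distr[OF x, of "-1" 1] smult_one[OF x] by simp
    qed
    then show ?case by (simp add: closed)
  next
    case (rel_uustar j k)
    show ?case using rels(1) by (rule fun_cong[THEN fun_cong])
  next
    case (rel_ustaru j k)
    show ?case using rels(2) by (rule fun_cong[THEN fun_cong])
  next
    case (rel_utQubarQinv j k)
    show ?case using rels(3) by (rule fun_cong[THEN fun_cong])
  next
    case (rel_QubarQinvut j k)
    show ?case using rels(4) by (rule fun_cong[THEN fun_cong])
  qed (simp_all add: closed a_ac m_assoc l_distr r_distr smult_closed star_closed
        smult_l_distr smult_r_distr smult_assoc smult_one smult_mult_left smult_mult_right
        star_star star_add star_smult star_mult)
qed

theorem A_u_universal: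
  assumes B: "star_algebra B" and v: "\<And>j k. v j k \<in> carrier B" and rel: "au_relations Q B v"
  shows "\<exists>f. star_hom (A_u Q) B f \<and> (\<forall>j k. f (au_gen Q j k) = v j k)"
proof -
  define f where "f X = (\<Union>t\<in>X. {au_term_eval B v t})" for X
  have f: "the_elem (f (au_class Q t)) = au_term_eval B v t" for t
  proof -
    have "f (au_class Q t) = {au_term_eval B v t}"
      unfolding f_def using au_term_eval_cong[OF B v rel]
      by (intro UN_const_au[of t]) (auto simp only: mem_au_class au_eq.refl)
    then show ?thesis by simp
  qed
  have "star_hom (A_u Q) B (the_elem \<circ> f)"
    unfolding star_hom_def
    by (auto intro!: ring_hom_memI elim!: A_u_cases
        simp: A_u_ops f au_term_eval_closed[OF B v])
  moreover have "(the_elem \<circ> f) (au_gen Q j k) = v j k" for j k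
    by (simp add: au_gen_def f)
  ultimately show ?thesis by blast
qed

theorem A_u_hom_unique:
  assumes B: "star_algebra B" and f: "star_hom (A_u Q) B f" and g: "star_hom (A_u Q) B g"
    and gen: "\<And>j k. f (au_gen Q j k) = g (au_gen Q j k)" and x: "x \<in> carrier (A_u Q)"
  shows "f x = g x"
proof -
  have fr: "f \<in> ring_hom (A_u Q) B" and gr: "g \<in> ring_hom (A_u Q) B"
    using f g by (auto simp: star_hom_def)
  have zero: "f \<zero>\<^bsub>A_u Q\<^esub> = g \<zero>\<^bsub>A_u Q\<^esub>"
    using ring_hom_zero[OF fr ring_A_u] ring_hom_zero[OF gr ring_A_u] B
    by (simp add: star_algebra_def)
  have "f (au_class Q t) = g (au_class Q t)" for t
  proof (induction t)
    case (TGen j k)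
    then show ?case using gen by (simp add: au_gen_def)
  next
    case TZero
    then show ?case using zero by (simp add: A_u_ops)
  next
    case TOne
    then show ?case using ring_hom_one[OF fr] ring_hom_one[OF gr] by (simp add: A_u_ops)
  next
    case (TAdd s t)
    then show ?case using ring_hom_add[OF fr] ring_hom_add[OF gr]
      by (simp add: A_u_ops[symmetric] au_class_closed)
  next
    case (TMult s t)
    then show ?case using ring_hom_mult[OF fr] ring_hom_mult[OF gr]
      by (simp add: A_u_ops[symmetric] au_class_closed)
  next
    case (TScale a t)
    then show ?case using f g by (simp add: star_hom_def A_u_ops[symmetric] au_class_closed)
  next
    case (TStar t)
    then show ?case using f g by (simp add: star_hom_def A_u_ops[symmetric] au_class_closed)
  qed
  then show ?thesis using x by (auto elim!: A_u_cases)
qed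

lemma star_algebra_complex: "star_algebra complex_star_algebra"
proof -
  have "Ring.ring complex_star_algebra"
  proof (rule ringI)
    show "abelian_group complex_star_algebra"
    proof (rule abelian_groupI)
      fix x :: complex
      show "\<exists>y\<in>carrier complex_star_algebra.
          y \<oplus>\<^bsub>complex_star_algebra\<^esub> x = \<zero>\<^bsub>complex_star_algebra\<^esub>"
        by (rule bexI[of _ "- x"]) (simp_all add: complex_star_algebra_def)
    qed (simp_all add: complex_star_algebra_def)
    show "Group.monoid complex_star_algebra"
      by (rule monoidI) (simp_all add: complex_star_algebra_def)
  qed (simp_all add: complex_star_algebra_def algebra_simps)
  then show ?thesis
    by (intro star_algebra.intro star_algebra_axioms.intro)
      (simp_all add: complex_star_algebra_def algebra_simps)
qed

lemma finsum_complex: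
  "finite I \<Longrightarrow> (\<Oplus>\<^bsub>complex_star_algebra\<^esub>p\<in>I. f p) = sum f I"
proof (induction I rule: finite_induct)
  case empty
  interpret star_algebra complex_star_algebra by (rule star_algebra_complex)
  show ?case by (simp add: complex_star_algebra_def finsum_def finprod_def)
next
  case (insert p I)
  interpret star_algebra complex_star_algebra by (rule star_algebra_complex)
  have "f \<in> insert p I \<rightarrow> carrier complex_star_algebra" by (simp add: complex_star_algebra_def)
  with insert show ?case
    by (subst finsum_insert) (auto simp: complex_star_algebra_def)
qed

lemma invertible_strictly_positive:
  assumes "strictly_positive Q"
  shows "invertible Q"
proof -
  have "v = 0" if "Q *v v = 0" for v
    using assms that by (force simp: strictly_positive_def)
  then show ?thesis
    by (simp add: invertible_left_inverse matrix_left_invertible_ker)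
qed

lemma ex_distinguished_character:
  fixes Q :: "complex ^ 'd ^ 'd::finite"
  assumes "strictly_positive Q"
  shows "\<exists>\<epsilon>. distinguished_character Q \<epsilon>"
proof -
  let ?C = complex_star_algebra
  let ?v = "\<lambda>(j::'d) k. if j = k then 1 else 0 :: complex"
  have inv: "Q ** matrix_inv Q = mat 1"
    using someI_ex[OF invertible_strictly_positive[OF assms, unfolded invertible_def]]
    by (simp add: matrix_inv_def)
  have mult: "amat_mult ?C X Y = (\<lambda>j k. \<Sum>p\<in>UNIV. X j p * Y p k)" for X Y :: "'d \<Rightarrow> 'd \<Rightarrow> complex"
    unfolding amat_mult_def by (simp add: finsum_complex) (simp add: complex_star_algebra_def)
  have "(\<Sum>p\<in>UNIV. Q $ j $ p * matrix_inv Q $ p $ k) = ?v j k" for j k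
    using arg_cong[OF inv, of "\<lambda>M. M $ j $ k"] by (simp add: matrix_matrix_mult_def mat_def)
  moreover have "amat_one ?C = ?v" "amat_of ?C M = (\<lambda>j k. M $ j $ k)"
      "amat_bar ?C ?v = ?v" "amat_transpose ?v = ?v" "amat_adjoint ?C ?v = ?v"
    for M :: "complex ^ 'd ^ 'd"
    by (auto simp: amat_one_def amat_of_def amat_bar_def amat_transpose_def amat_adjoint_def
        complex_star_algebra_def fun_eq_iff)
  ultimately have "au_relations Q ?C ?v"
    by (simp add: au_relations_def mult if_distrib[of "\<lambda>x. _ * x"] if_distrib[of "\<lambda>x. x * _"]
        cong: if_cong)
  from A_u_universal[OF star_algebra_complex _ this] show ?thesis
    by (auto simp: distinguished_character_def complex_star_algebra_def)
qed

text \<open>The bilinear form attached to two 1-cocycles is a 2-cocycle.\<close>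

lemma two_cocycle_of_one_cocycles:
  fixes \<pi> :: "'a \<Rightarrow> 'h::complex_hilbert_space \<Rightarrow> 'h"
  assumes A: "star_algebra A" and rep: "representation A \<pi>"
    and eps: "star_hom A complex_star_algebra \<epsilon>"
    and \<eta>\<^sub>1: "\<eta>\<^sub>1 \<in> one_cocycles A \<pi> \<epsilon>" and \<eta>\<^sub>2: "\<eta>\<^sub>2 \<in> one_cocycles A \<pi> \<epsilon>"
  shows "two_cocycle A \<epsilon> (\<lambda>x y. cinner (\<eta>\<^sub>1 (star A x)) (\<eta>\<^sub>2 y))"
proof -
  interpret star_algebra A by fact
  have add_left: "cinner (x + y) z = cinner x z + cinner y z" for x y z :: 'h
    by (metis cinner_add_right cinner_commute complex_cnj_add)
  have scale_left: "cinner (a *\<^sub>C x) y = cnj a * cinner x y" for a and x y :: 'h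
    by (metis cinner_scaleC_right cinner_commute complex_cnj_mult)
  have eps_star: "\<epsilon> (star A x) = cnj (\<epsilon> x)" if "x \<in> carrier A" for x
    using eps that by (simp add: star_hom_def complex_star_algebra_def)
  have adj: "cinner (\<pi> (star A x) h) k = cinner h (\<pi> x k)" if "x \<in> carrier A" for x h k
    using rep that by (simp add: representation_def is_adjoint_def)
  show ?thesis
    using \<eta>\<^sub>1 \<eta>\<^sub>2
    unfolding two_cocycle_def bilinear_form_def one_cocycles_def
    by (auto simp: star_closed smult_closed star_add star_smult star_mult add_left scale_left
        cinner_add_right cinner_scaleC_right eps_star adj algebra_simps)
qed

end

theory Submission
  imports Defs
begin

text \<open>Index the generators by the eigenvalue classes of \<open>Q\<close>, and write \<open>u\<^sub>q\<^sub>r\<close> for the block of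
  entries \<open>u\<^sub>j\<^sub>k\<close> with \<open>Q\<^sub>j = q\<close> and \<open>Q\<^sub>k = r\<close>.  Let \<open>a(q, r)\<close> be the sum of
  \<open>cinner (\<eta>\<^sub>1 u\<^sub>j\<^sub>k) (\<eta>\<^sub>2 u\<^sub>j\<^sub>k)\<close> over this block and \<open>b(q, r)\<close> the same sum with \<open>u\<^sub>j\<^sub>k\<^sup>*\<close> in place of
  \<open>u\<^sub>j\<^sub>k\<close>.  The trace of the defect over the \<open>q\<close>-block is \<open>\<Sum>\<^sub>r a(r, q) - \<Sum>\<^sub>r (q / r) a(q, r)\<close>.  The
  two terms with \<open>r = q\<close> cancel, so it suffices that \<open>a(q, r) = 0\<close> for \<open>q \<noteq> r\<close>.

  For this, apply a cocycle to the relation \<open>u u\<^sup>* = I\<close>.  Since the character is trivial on \<open>u\<close>, this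
  expresses \<open>\<eta>(u\<^sub>j\<^sub>k)\<close> as \<open>- \<Sum>\<^sub>p \<pi>(u\<^sub>j\<^sub>p) \<eta>(u\<^sub>k\<^sub>p\<^sup>*)\<close>, where only the \<open>p\<close> in the class of \<open>j\<close>
  contribute because \<open>\<pi>\<close> is a \<open>Q\<close>-representation (\<open>cocycle_u\<close>).  The last
  defining relation, which involves \<open>Q\<close>, the entrywise adjoint of \<open>u\<close> and its transpose,
  expresses \<open>\<eta>(u\<^sub>j\<^sub>k\<^sup>*)\<close> through the \<open>\<eta>(u\<^sub>k\<^sub>p)\<close> in the same way, but with a factor \<open>Q\<^sub>k / Q\<^sub>j\<close> (\<open>cocycle_star_u\<close>).  The operator matrices that occur here are
  isometric (\<open>block_isometry\<close>), so they preserve the sums of inner products, and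
  \<open>a(q, r) = b(r, q) = (q / r)\<^sup>2 a(q, r)\<close>.  As \<open>q\<close> and \<open>r\<close> are positive and distinct,
  \<open>a(q, r) = 0\<close> (\<open>block_pairing_off_diagonal\<close>).\<close>


section \<open>Inner products and operator matrices\<close>

lemma cinner_add_left: "cinner (x + y) z = cinner x z + cinner y (z :: 'h::complex_hilbert_space)"
  by (metis cinner_add_right cinner_commute complex_cnj_add)

lemma cinner_scaleC_left:
  "cinner (a *\<^sub>C x) y = cnj a * cinner x (y :: 'h::complex_hilbert_space)"
  by (metis cinner_scaleC_right cinner_commute complex_cnj_mult)

lemma cinner_zero_right [simp]: "cinner x (0 :: 'h::complex_hilbert_space) = 0"
  using cinner_add_right[of x 0 0] by simp

lemma cinner_zero_left [simp]: "cinner (0 :: 'h::complex_hilbert_space) x = 0"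
  using cinner_add_left[of 0 0 x] by simp

lemma cinner_sum_right:
  "cinner (x :: 'h::complex_hilbert_space) (\<Sum>i\<in>I. f i) = (\<Sum>i\<in>I. cinner x (f i))"
  by (induction I rule: infinite_finite_induct) (auto simp: cinner_add_right)

lemma cinner_sum_left:
  "cinner (\<Sum>i\<in>I. f i) (x :: 'h::complex_hilbert_space) = (\<Sum>i\<in>I. cinner (f i) x)"
  by (induction I rule: infinite_finite_induct) (auto simp: cinner_add_left)

lemma scaleC_zero_right [simp]: "a *\<^sub>C (0 :: 'h::complex_hilbert_space) = 0"
  using scaleC_add_right[of a 0 0] by simp

lemma scaleC_zero_left [simp]: "0 *\<^sub>C (x :: 'h::complex_hilbert_space) = 0"
  using scaleC_add_left[of 0 0 x] by simp

lemma scaleC_one [simp]: "1 *\<^sub>C (x :: 'h::complex_hilbert_space) = x"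
  using scaleR_scaleC[of 1 x] by simp

lemma scaleC_minus_one: "(-1) *\<^sub>C (x :: 'h::complex_hilbert_space) = - x"
  using scaleR_scaleC[of "-1" x] by simp

lemma cinner_minus_minus: "cinner (- x) (- y) = cinner x (y :: 'h::complex_hilbert_space)"
  by (simp add: scaleC_minus_one[symmetric] cinner_scaleC_left cinner_scaleC_right)

lemma cinner_scaleC_of_real:
  "cinner (complex_of_real a *\<^sub>C x) (complex_of_real a *\<^sub>C y)
    = complex_of_real (a\<^sup>2) * cinner x (y :: 'h::complex_hilbert_space)"
  by (simp add: cinner_scaleC_left cinner_scaleC_right power2_eq_square)

lemma cinner_self_eq_0_iff: "cinner x x = 0 \<longleftrightarrow> x = (0 :: 'h::complex_hilbert_space)"
  by (simp add: cinner_self)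

text \<open>The hypotheses say \<open>T\<^sup>* T = I\<close> for the operator matrix \<open>T\<close> acting on the direct sum of
  copies of the Hilbert space indexed by \<open>J\<close>; such an operator preserves inner products.\<close>

lemma operator_matrix_isometry:
  fixes T T' :: "'i \<Rightarrow> 'i \<Rightarrow> 'h::complex_hilbert_space \<Rightarrow> 'h"
  assumes "finite J"
    and adj: "\<And>j p. is_adjoint (T j p) (T' j p)"
    and isom: "\<And>p r h. p \<in> J \<Longrightarrow> r \<in> J \<Longrightarrow> (\<Sum>j\<in>J. T' j p (T j r h)) = (if p = r then h else 0)"
  shows "(\<Sum>j\<in>J. cinner (\<Sum>p\<in>J. T j p (x p)) (\<Sum>r\<in>J. T j r (y r))) = (\<Sum>p\<in>J. cinner (x p) (y p))"
proof -
  have "(\<Sum>j\<in>J. cinner (\<Sum>p\<in>J. T j p (x p)) (\<Sum>r\<in>J. T j r (y r)))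
      = (\<Sum>j\<in>J. \<Sum>p\<in>J. \<Sum>r\<in>J. cinner (x p) (T' j p (T j r (y r))))"
    using adj unfolding cinner_sum_left unfolding cinner_sum_right by (simp add: is_adjoint_def)
  also have "\<dots> = (\<Sum>p\<in>J. \<Sum>r\<in>J. \<Sum>j\<in>J. cinner (x p) (T' j p (T j r (y r))))"
    by (subst sum.swap, rule sum.cong[OF HOL.refl], rule sum.swap)
  also have "\<dots> = (\<Sum>p\<in>J. \<Sum>r\<in>J. cinner (x p) (if p = r then y r else 0))"
    by (rule sum.cong[OF HOL.refl], rule sum.cong[OF HOL.refl], subst cinner_sum_right[symmetric])
      (simp only: isom)
  also have "\<dots> = (\<Sum>p\<in>J. \<Sum>r\<in>J. if p = r then cinner (x p) (y r) else 0)"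
    by (intro sum.cong HOL.refl) simp
  also have "\<dots> = (\<Sum>p\<in>J. cinner (x p) (y p))"
    using \<open>finite J\<close> by simp
  finally show ?thesis .
qed


section \<open>The defining relations for a diagonal parameter matrix\<close>

text \<open>The diagonal entry is the value of the quadratic form of \<open>Q\<close> at a unit vector.\<close>

lemma diagonal_entry_pos:
  assumes "strictly_positive Q"
  shows "\<exists>r>0. Q $ j $ j = complex_of_real r"
proof -
  have "axis j (1::complex) \<noteq> 0" by simp
  then obtain r where "r > 0"
      "(\<Sum>i\<in>UNIV. cnj (axis j 1 $ i) * (Q *v axis j 1) $ i) = complex_of_real r"
    using assms unfolding strictly_positive_def by blast
  moreover have "(\<Sum>i\<in>UNIV. cnj (axis j 1 $ i) * (Q *v axis j 1) $ i) = Q $ j $ j"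
    by (simp add: axis_def matrix_vector_mult_def if_distrib[of "\<lambda>x. _ * x"]
        if_distrib[of "\<lambda>x. x * _"] if_distrib[of cnj] cong: if_cong)
  ultimately show ?thesis by auto
qed

lemma matrix_inv_diagonal:
  fixes Q :: "complex ^ 'd ^ 'd::finite"
  assumes "diagonal_matrix Q" and nz: "\<And>j. Q $ j $ j \<noteq> 0"
  shows "matrix_inv Q $ j $ k = (if j = k then 1 / Q $ j $ j else 0)"
proof -
  define D :: "complex ^ 'd ^ 'd" where "D = (\<chi> j k. if j = k then 1 / Q $ j $ j else 0)"
  have Q: "Q $ j $ k = (if j = k then Q $ j $ j else 0)" for j k
    using assms(1) by (simp add: diagonal_matrix_def)
  have "Q ** D = mat 1"
    by (subst vec_eq_iff, subst vec_eq_iff, subst matrix_matrix_mult_def, subst Q)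
      (simp add: D_def mat_def nz if_distrib[of "\<lambda>x. _ * x"] if_distrib[of "\<lambda>x. x * _"] cong: if_cong)
  moreover from this have "D ** Q = mat 1"
    by (simp add: matrix_left_right_inverse)
  ultimately have "\<exists>D. Q ** D = mat 1 \<and> D ** Q = mat 1" by blast
  then have "matrix_inv Q ** Q = mat 1"
    unfolding matrix_inv_def by (rule someI2_ex) simp
  with \<open>Q ** D = mat 1\<close> have "matrix_inv Q = D"
    by (metis matrix_mul_assoc matrix_mul_lid matrix_mul_rid)
  then show ?thesis by (simp add: D_def)
qed

context star_algebra
begin

lemma smult_zero_left: assumes x: "x \<in> carrier A" shows "0 \<odot> x = \<zero>"
proof -
  have "0 \<odot> x \<oplus> 0 \<odot> x = 0 \<odot> x"
    using smult_l_distr[OF x, of 0 0] by simp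
  then show ?thesis using smult_closed[OF x, of 0] by (metis add.l_cancel_one)
qed

lemma finsum_single:
  assumes "\<And>p. f p \<in> carrier A"
  shows "(\<Oplus>p\<in>(UNIV :: 'd::finite set). if p = k then f p else \<zero>) = f k"
proof -
  have "(\<Oplus>p\<in>UNIV. if k = p then f p else \<zero>) = f k"
    by (rule add.finprod_singleton) (auto simp: assms)
  then show ?thesis by (simp add: eq_commute[of k])
qed

lemma smult_finsum:
  assumes "finite I" "\<And>i. i \<in> I \<Longrightarrow> f i \<in> carrier A"
  shows "a \<odot> (\<Oplus>i\<in>I. f i) = (\<Oplus>i\<in>I. a \<odot> f i)"
  using assms
proof (induction I rule: finite_induct)
  case empty
  have "a \<odot> \<zero> = \<zero>"
    using smult_assoc[of \<zero> a 0] by (simp add: smult_zero_left)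
  then show ?case by simp
next
  case (insert i I)
  then show ?case by (simp add: smult_closed smult_r_distr finsum_closed Pi_def)
qed

lemma additive_finsum:
  fixes \<phi> :: "'a \<Rightarrow> 'v::ab_group_add"
  assumes add: "\<And>x y. x \<in> carrier A \<Longrightarrow> y \<in> carrier A \<Longrightarrow> \<phi> (x \<oplus> y) = \<phi> x + \<phi> y"
    and "finite I" "\<And>i. i \<in> I \<Longrightarrow> f i \<in> carrier A"
  shows "\<phi> (\<Oplus>i\<in>I. f i) = (\<Sum>i\<in>I. \<phi> (f i))"
  using assms(2,3)
proof (induction I rule: finite_induct)
  case empty
  show ?case using add[of \<zero> \<zero>] by simp
next
  case (insert i I)
  then show ?case by (subst finsum_insert) (auto simp: add)
qed

end

lemma diagonal_amat_mult_left:
  fixes A :: "'a star_algebra" (structure) and M :: "complex ^ 'd ^ 'd::finite"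
  assumes "star_algebra A"
    and "\<And>j k. M $ j $ k = (if j = k then m j else 0)" "\<And>j k. X j k \<in> carrier A"
  shows "amat_mult A (amat_of A M) X = (\<lambda>j k. m j \<odot> X j k)"
proof (intro ext)
  fix j k
  interpret star_algebra A by fact
  have "amat_mult A (amat_of A M) X j k = (\<Oplus>p\<in>UNIV. if p = j then m p \<odot> X p k else \<zero>)"
    unfolding amat_mult_def amat_of_def
    by (rule finsum_cong') (auto simp: assms smult_closed smult_mult_left smult_zero_left)
  then show "amat_mult A (amat_of A M) X j k = m j \<odot> X j k"
    by (simp add: finsum_single assms smult_closed)
qed

lemma diagonal_amat_mult_right:
  fixes A :: "'a star_algebra" (structure) and M :: "complex ^ 'd ^ 'd::finite"
  assumes "star_algebra A"
    and "\<And>j k. M $ j $ k = (if j = k then m j else 0)" "\<And>j k. X j k \<in> carrier A"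
  shows "amat_mult A X (amat_of A M) = (\<lambda>j k. m k \<odot> X j k)"
proof (intro ext)
  fix j k
  interpret star_algebra A by fact
  have "amat_mult A X (amat_of A M) j k = (\<Oplus>p\<in>UNIV. if p = k then m p \<odot> X j p else \<zero>)"
    unfolding amat_mult_def amat_of_def
    by (rule finsum_cong') (auto simp: assms smult_closed smult_mult_right smult_zero_left)
  then show "amat_mult A X (amat_of A M) j k = m k \<odot> X j k"
    by (simp add: finsum_single assms smult_closed)
qed


section \<open>Cocycles over block-diagonal representations\<close>

text \<open>The argument uses the algebra only through its relations, so the setting is any
  star-algebra with a matrix \<open>u\<close> satisfying them.  They are written out in coordinates for the
  diagonal parameter matrix with entries \<open>w\<close>, since the block structure lives there.
  With \<open>w\<close> real, positivity of the eigenvalues becomes an ordinary inequality.\<close>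

locale block_representation = star_algebra A for A :: "'a star_algebra" (structure) +
  fixes w :: "'d::finite \<Rightarrow> real" and u :: "'d \<Rightarrow> 'd \<Rightarrow> 'a"
    and \<pi> :: "'a \<Rightarrow> 'h::complex_hilbert_space \<Rightarrow> 'h" and \<epsilon> :: "'a \<Rightarrow> complex"
  assumes w_pos: "w j > 0"
    and u_closed: "u j k \<in> carrier A"
    and u_ustar: "(\<Oplus>p\<in>UNIV. u j p \<otimes> star A (u k p)) = amat_one A j k"
    and ustar_u: "(\<Oplus>p\<in>UNIV. star A (u p j) \<otimes> u p k) = amat_one A j k"
    and ut_ubar: "(\<Oplus>p\<in>UNIV. complex_of_real (w p / w k) \<odot> (u p j \<otimes> star A (u p k)))
      = amat_one A j k"
    and ubar_ut: "(\<Oplus>p\<in>UNIV. complex_of_real (w j / w p) \<odot> (star A (u j p) \<otimes> u k p))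
      = amat_one A j k"
    and rep: "representation A \<pi>"
    and block: "w j \<noteq> w k \<Longrightarrow> \<pi> (u j k) = (\<lambda>_. 0)"
    and eps_one: "\<epsilon> \<one> = 1"
    and eps_u: "\<epsilon> (u j k) = (if j = k then 1 else 0)"
    and eps_star_u: "\<epsilon> (star A (u j k)) = (if j = k then 1 else 0)"
begin

lemma closed [simp, intro]:
  "u j k \<in> carrier A" "star A (u j k) \<in> carrier A"
  "x \<in> carrier A \<Longrightarrow> a \<odot> x \<in> carrier A"
  by (auto simp: u_closed star_closed smult_closed)

lemma rep_simps:
  "x \<in> carrier A \<Longrightarrow> y \<in> carrier A \<Longrightarrow> \<pi> (x \<oplus> y) h = \<pi> x h + \<pi> y h"
  "x \<in> carrier A \<Longrightarrow> \<pi> (a \<odot> x) h = a *\<^sub>C \<pi> x h"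
  "x \<in> carrier A \<Longrightarrow> y \<in> carrier A \<Longrightarrow> \<pi> (x \<otimes> y) h = \<pi> x (\<pi> y h)"
  "\<pi> \<one> h = h"
  using rep by (auto simp: representation_def)

lemma rep_finsum:
  "finite I \<Longrightarrow> (\<And>i. i \<in> I \<Longrightarrow> f i \<in> carrier A) \<Longrightarrow> \<pi> (\<Oplus>i\<in>I. f i) h = (\<Sum>i\<in>I. \<pi> (f i) h)"
  by (rule additive_finsum[where \<phi> = "\<lambda>x. \<pi> x h"]) (auto simp: rep_simps)

lemma rep_amat_one: "\<pi> (amat_one A j k) h = (if j = k then h else 0)"
  using rep_finsum[of "{}" "\<lambda>_. \<zero>" h] by (simp add: amat_one_def rep_simps)

lemma rep_star_adjoint: "is_adjoint (\<pi> (star A (u j k))) (\<pi> (u j k))"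
  using rep by (auto simp: representation_def)

lemma rep_adjoint: "is_adjoint (\<pi> (u j k)) (\<pi> (star A (u j k)))"
  using rep_star_adjoint[of j k] unfolding is_adjoint_def by (metis cinner_commute)

lemma block_star:
  assumes "w j \<noteq> w k"
  shows "\<pi> (star A (u j k)) = (\<lambda>_. 0)"
proof
  fix h
  have "cinner (\<pi> (star A (u j k)) h) (\<pi> (star A (u j k)) h) = 0"
    using rep_star_adjoint[of j k] block[OF assms] by (simp add: is_adjoint_def)
  then show "\<pi> (star A (u j k)) h = 0" by (simp add: cinner_self_eq_0_iff)
qed

definition block_indices :: "real \<Rightarrow> 'd set" where
  "block_indices q = {j. w j = q}"

lemma block_indices_iff [simp]: "j \<in> block_indices q \<longleftrightarrow> w j = q"
  by (simp add: block_indices_def)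

text \<open>Inside one block the weights \<open>w j / w r\<close> are \<open>1\<close>, so the diagonal blocks of \<open>u\<close> and
  of its entrywise adjoint both become isometries; by block-diagonality of the representation
  nothing is lost when the relations are restricted to one block.\<close>

lemma block_isometry:
  assumes "w p = q" "w r = q"
  shows "(\<Sum>j\<in>block_indices q. \<pi> (star A (u j p)) (\<pi> (u j r) h)) = (if p = r then h else 0)"
    (is ?u)
    and "(\<Sum>j\<in>block_indices q. \<pi> (u j p) (\<pi> (star A (u j r)) h)) = (if p = r then h else 0)"
    (is ?ubar)
proof -
  have "(\<Sum>j\<in>block_indices q. \<pi> (star A (u j p)) (\<pi> (u j r) h))
      = (\<Sum>j\<in>UNIV. \<pi> (star A (u j p)) (\<pi> (u j r) h))"
    using assms by (intro sum.mono_neutral_left) (auto simp: block_star)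
  also have "\<dots> = \<pi> (\<Oplus>j\<in>UNIV. star A (u j p) \<otimes> u j r) h"
    by (simp add: rep_finsum rep_simps)
  finally show ?u by (simp add: ustar_u rep_amat_one)
  have "(\<Sum>j\<in>block_indices q. \<pi> (u j p) (\<pi> (star A (u j r)) h))
      = (\<Sum>j\<in>block_indices q. complex_of_real (w j / w r) *\<^sub>C \<pi> (u j p) (\<pi> (star A (u j r)) h))"
    using assms w_pos[of r] by (intro sum.cong) auto
  also have "\<dots> = (\<Sum>j\<in>UNIV. complex_of_real (w j / w r) *\<^sub>C \<pi> (u j p) (\<pi> (star A (u j r)) h))"
    using assms by (intro sum.mono_neutral_left) (auto simp: block)
  also have "\<dots> = \<pi> (\<Oplus>j\<in>UNIV. complex_of_real (w j / w r) \<odot> (u j p \<otimes> star A (u j r))) h"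
    by (simp add: rep_finsum rep_simps)
  finally show ?ubar by (simp only: ut_ubar rep_amat_one)
qed

lemma cocycle_simps:
  assumes "\<eta> \<in> one_cocycles A \<pi> \<epsilon>"
  shows "x \<in> carrier A \<Longrightarrow> y \<in> carrier A \<Longrightarrow> \<eta> (x \<oplus> y) = \<eta> x + \<eta> y"
    "x \<in> carrier A \<Longrightarrow> \<eta> (a \<odot> x) = a *\<^sub>C \<eta> x"
    "x \<in> carrier A \<Longrightarrow> y \<in> carrier A \<Longrightarrow> \<eta> (x \<otimes> y) = \<pi> x (\<eta> y) + \<epsilon> y *\<^sub>C \<eta> x"
  using assms by (auto simp: one_cocycles_def)

lemma cocycle_finsum:
  assumes "\<eta> \<in> one_cocycles A \<pi> \<epsilon>"
  shows "finite I \<Longrightarrow> (\<And>i. i \<in> I \<Longrightarrow> f i \<in> carrier A) \<Longrightarrow> \<eta> (\<Oplus>i\<in>I. f i) = (\<Sum>i\<in>I. \<eta> (f i))"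
  by (rule additive_finsum) (auto simp: cocycle_simps[OF assms])

text \<open>A cocycle is a derivation into a bimodule, so it kills the unit and hence the
  right-hand sides of all four relations.\<close>

lemma cocycle_amat_one:
  assumes "\<eta> \<in> one_cocycles A \<pi> \<epsilon>"
  shows "\<eta> (amat_one A j k) = 0"
proof -
  have "\<eta> \<zero> = 0" using cocycle_finsum[OF assms, of "{}" "\<lambda>_. \<zero>"] by simp
  moreover have "\<eta> \<one> = \<eta> \<one> + \<eta> \<one>"
    using cocycle_simps(3)[OF assms, of \<one> \<one>] by (simp add: rep_simps eps_one)
  ultimately show ?thesis by (simp add: amat_one_def)
qed

text \<open>Apply the cocycle to \<open>u u\<^sup>* = I\<close> and solve for the single term that the character leaves
  from \<open>\<eta> (u j p) \<epsilon> (u k p\<^sup>*)\<close>.\<close>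

lemma cocycle_u:
  assumes \<eta>: "\<eta> \<in> one_cocycles A \<pi> \<epsilon>"
  shows "\<eta> (u j k) = - (\<Sum>p\<in>block_indices (w j). \<pi> (u j p) (\<eta> (star A (u k p))))"
proof -
  have "0 = \<eta> (\<Oplus>p\<in>UNIV. u j p \<otimes> star A (u k p))"
    by (simp add: u_ustar cocycle_amat_one[OF \<eta>])
  also have "\<dots> = (\<Sum>p\<in>UNIV. \<pi> (u j p) (\<eta> (star A (u k p))) + (if k = p then \<eta> (u j p) else 0))"
    by (subst cocycle_finsum[OF \<eta>]) (auto simp: cocycle_simps[OF \<eta>] eps_star_u intro!: sum.cong)
  also have "\<dots> = (\<Sum>p\<in>UNIV. \<pi> (u j p) (\<eta> (star A (u k p)))) + \<eta> (u j k)"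
    by (simp add: sum.distrib)
  also have "(\<Sum>p\<in>UNIV. \<pi> (u j p) (\<eta> (star A (u k p))))
      = (\<Sum>p\<in>block_indices (w j). \<pi> (u j p) (\<eta> (star A (u k p))))"
    by (intro sum.mono_neutral_right) (auto simp: block)
  finally show ?thesis by (simp add: eq_neg_iff_add_eq_0 add.commute)
qed

text \<open>The same argument for the relation \<open>ubar_ut\<close>.  The weight is \<open>1\<close> on the terms that come
  from the representation, which all lie in the block of \<open>j\<close>, but it is \<open>w j / w k\<close> on the term
  that the character leaves.  This asymmetry is what makes the off-diagonal blocks vanish.\<close>

lemma cocycle_star_u:
  assumes \<eta>: "\<eta> \<in> one_cocycles A \<pi> \<epsilon>"
  shows "\<eta> (star A (u j k)) = complex_of_real (- (w k / w j)) *\<^sub>C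
    (\<Sum>p\<in>block_indices (w j). \<pi> (star A (u j p)) (\<eta> (u k p)))"
proof -
  let ?s = "\<Sum>p\<in>block_indices (w j). \<pi> (star A (u j p)) (\<eta> (u k p))"
  have "0 = \<eta> (\<Oplus>p\<in>UNIV. complex_of_real (w j / w p) \<odot> (star A (u j p) \<otimes> u k p))"
    by (simp only: ubar_ut cocycle_amat_one[OF \<eta>])
  also have "\<dots> = (\<Sum>p\<in>UNIV. complex_of_real (w j / w p) *\<^sub>C \<pi> (star A (u j p)) (\<eta> (u k p))
      + (if k = p then complex_of_real (w j / w p) *\<^sub>C \<eta> (star A (u j p)) else 0))"
    by (subst cocycle_finsum[OF \<eta>])
      (auto simp: cocycle_simps[OF \<eta>] eps_u scaleC_add_right intro!: sum.cong)
  also have "\<dots> = (\<Sum>p\<in>UNIV. complex_of_real (w j / w p) *\<^sub>C \<pi> (star A (u j p)) (\<eta> (u k p)))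
      + complex_of_real (w j / w k) *\<^sub>C \<eta> (star A (u j k))"
    by (simp add: sum.distrib)
  also have "(\<Sum>p\<in>UNIV. complex_of_real (w j / w p) *\<^sub>C \<pi> (star A (u j p)) (\<eta> (u k p)))
      = (\<Sum>p\<in>block_indices (w j). complex_of_real (w j / w p) *\<^sub>C \<pi> (star A (u j p)) (\<eta> (u k p)))"
    by (intro sum.mono_neutral_right) (auto simp: block_star)
  also have "\<dots> = ?s"
    using w_pos[of j] by (intro sum.cong) auto
  finally have eq: "complex_of_real (w j / w k) *\<^sub>C \<eta> (star A (u j k)) = (-1) *\<^sub>C ?s"
    by (simp add: scaleC_minus_one eq_neg_iff_add_eq_0 add.commute)
  have "\<eta> (star A (u j k))
      = complex_of_real (w k / w j) *\<^sub>C complex_of_real (w j / w k) *\<^sub>C \<eta> (star A (u j k))"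
    using w_pos[of j] w_pos[of k] by (simp add: scaleC_scaleC less_imp_neq[symmetric])
  also have "\<dots> = complex_of_real (- (w k / w j)) *\<^sub>C ?s"
    unfolding eq by (simp add: scaleC_scaleC)
  finally show ?thesis .
qed

definition block_pairing :: "('a \<Rightarrow> 'h) \<Rightarrow> ('a \<Rightarrow> 'h) \<Rightarrow> real \<Rightarrow> real \<Rightarrow> complex" where
  "block_pairing \<eta> \<theta> q r =
     (\<Sum>j\<in>block_indices q. \<Sum>k\<in>block_indices r. cinner (\<eta> (u j k)) (\<theta> (u j k)))"

definition block_pairing_star :: "('a \<Rightarrow> 'h) \<Rightarrow> ('a \<Rightarrow> 'h) \<Rightarrow> real \<Rightarrow> real \<Rightarrow> complex" where
  "block_pairing_star \<eta> \<theta> q r =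
     (\<Sum>j\<in>block_indices q. \<Sum>k\<in>block_indices r. cinner (\<eta> (star A (u j k))) (\<theta> (star A (u j k))))"

text \<open>For fixed \<open>k\<close>, the vector of all \<open>\<eta> (u j k)\<close> with \<open>j\<close> in a block is, up to sign, an isometry
  applied to the vector of all \<open>\<eta> (u k p\<^sup>*)\<close>, and the isometry is the same for both cocycles.\<close>

lemma block_pairing_eq_star:
  assumes \<eta>: "\<eta> \<in> one_cocycles A \<pi> \<epsilon>" and \<theta>: "\<theta> \<in> one_cocycles A \<pi> \<epsilon>"
  shows "block_pairing \<eta> \<theta> q r = block_pairing_star \<eta> \<theta> r q"
proof -
  have "(\<Sum>j\<in>block_indices q. cinner (\<eta> (u j k)) (\<theta> (u j k)))
      = (\<Sum>p\<in>block_indices q. cinner (\<eta> (star A (u k p))) (\<theta> (star A (u k p))))" for k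
  proof -
    have "(\<Sum>j\<in>block_indices q. cinner (\<eta> (u j k)) (\<theta> (u j k)))
      = (\<Sum>j\<in>block_indices q. cinner (\<Sum>p\<in>block_indices q. \<pi> (u j p) (\<eta> (star A (u k p))))
          (\<Sum>p\<in>block_indices q. \<pi> (u j p) (\<theta> (star A (u k p)))))"
    proof (rule sum.cong[OF HOL.refl])
      fix j assume "j \<in> block_indices q"
      then have "w j = q" by simp
      then show "cinner (\<eta> (u j k)) (\<theta> (u j k))
        = cinner (\<Sum>p\<in>block_indices q. \<pi> (u j p) (\<eta> (star A (u k p))))
          (\<Sum>p\<in>block_indices q. \<pi> (u j p) (\<theta> (star A (u k p))))"
        by (simp only: cocycle_u[OF \<eta>, of j k] cocycle_u[OF \<theta>, of j k] cinner_minus_minus)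
    qed
    also have "\<dots> = (\<Sum>p\<in>block_indices q. cinner (\<eta> (star A (u k p))) (\<theta> (star A (u k p))))"
      by (rule operator_matrix_isometry[where T' = "\<lambda>j p. \<pi> (star A (u j p))"])
        (simp_all add: rep_adjoint block_isometry)
    finally show ?thesis .
  qed
  then show ?thesis
    unfolding block_pairing_def block_pairing_star_def by (subst sum.swap) simp
qed

text \<open>The converse exchange, through the entrywise adjoint of \<open>u\<close>.  The scalar of
  \<open>cocycle_star_u\<close> enters both arguments of the inner product and is therefore squared.\<close>

lemma block_pairing_star_eq:
  assumes \<eta>: "\<eta> \<in> one_cocycles A \<pi> \<epsilon>" and \<theta>: "\<theta> \<in> one_cocycles A \<pi> \<epsilon>"
  shows "block_pairing_star \<eta> \<theta> q r = complex_of_real ((r / q)\<^sup>2) * block_pairing \<eta> \<theta> r q"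
proof -
  have "(\<Sum>j\<in>block_indices q. cinner (\<eta> (star A (u j k))) (\<theta> (star A (u j k))))
      = complex_of_real ((r / q)\<^sup>2) * (\<Sum>p\<in>block_indices q. cinner (\<eta> (u k p)) (\<theta> (u k p)))"
    if k: "k \<in> block_indices r" for k
  proof -
    have "(\<Sum>j\<in>block_indices q. cinner (\<eta> (star A (u j k))) (\<theta> (star A (u j k))))
      = complex_of_real ((r / q)\<^sup>2) *
        (\<Sum>j\<in>block_indices q. cinner (\<Sum>p\<in>block_indices q. \<pi> (star A (u j p)) (\<eta> (u k p)))
          (\<Sum>p\<in>block_indices q. \<pi> (star A (u j p)) (\<theta> (u k p))))"
      unfolding sum_distrib_left
    proof (rule sum.cong[OF HOL.refl])
      fix j assume "j \<in> block_indices q"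
      then have "w j = q" "w k = r" using k by simp_all
      then show "cinner (\<eta> (star A (u j k))) (\<theta> (star A (u j k)))
        = complex_of_real ((r / q)\<^sup>2) *
          cinner (\<Sum>p\<in>block_indices q. \<pi> (star A (u j p)) (\<eta> (u k p)))
            (\<Sum>p\<in>block_indices q. \<pi> (star A (u j p)) (\<theta> (u k p)))"
        by (simp only: cocycle_star_u[OF \<eta>, of j k] cocycle_star_u[OF \<theta>, of j k]
            cinner_scaleC_of_real power2_minus)
    qed
    also have "(\<Sum>j\<in>block_indices q. cinner (\<Sum>p\<in>block_indices q. \<pi> (star A (u j p)) (\<eta> (u k p)))
          (\<Sum>p\<in>block_indices q. \<pi> (star A (u j p)) (\<theta> (u k p))))
      = (\<Sum>p\<in>block_indices q. cinner (\<eta> (u k p)) (\<theta> (u k p)))"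
      by (rule operator_matrix_isometry[where T' = "\<lambda>j p. \<pi> (u j p)"])
        (simp_all add: rep_star_adjoint block_isometry)
    finally show ?thesis .
  qed
  then show ?thesis
    unfolding block_pairing_def block_pairing_star_def
    by (subst sum.swap) (simp add: sum_distrib_left)
qed

text \<open>The two exchanges together lead from the \<open>(w j, w k)\<close> block back to itself, with a factor
  that differs from \<open>1\<close> because the weights are positive and distinct.\<close>

lemma block_pairing_off_diagonal:
  assumes \<eta>: "\<eta> \<in> one_cocycles A \<pi> \<epsilon>" and \<theta>: "\<theta> \<in> one_cocycles A \<pi> \<epsilon>"
    and neq: "w j \<noteq> w k"
  shows "block_pairing \<eta> \<theta> (w j) (w k) = 0"
proof -
  have "block_pairing \<eta> \<theta> (w j) (w k)
      = complex_of_real ((w j / w k)\<^sup>2) * block_pairing \<eta> \<theta> (w j) (w k)"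
    by (rule HOL.trans[OF block_pairing_eq_star[OF \<eta> \<theta>] block_pairing_star_eq[OF \<eta> \<theta>]])
  moreover have "(w j / w k)\<^sup>2 \<noteq> 1"
    using w_pos[of j] w_pos[of k] neq by (auto simp: power2_eq_1_iff divide_eq_eq)
  then have "complex_of_real ((w j / w k)\<^sup>2) \<noteq> 1" by (simp only: of_real_eq_1_iff not_False_eq_True)
  ultimately show ?thesis by (simp only: mult_cancel_right1 simp_thms)
qed

text \<open>Both sides collapse to the pairing of the diagonal block: the off-diagonal blocks vanish
  and on the diagonal one the weight \<open>w j / w p\<close> is \<open>1\<close>.\<close>

lemma block_trace_eq:
  assumes \<eta>: "\<eta> \<in> one_cocycles A \<pi> \<epsilon>" and \<theta>: "\<theta> \<in> one_cocycles A \<pi> \<epsilon>"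
  shows "(\<Sum>j\<in>block_indices q. \<Sum>p\<in>UNIV. cinner (\<eta> (u p j)) (\<theta> (u p j)))
    = (\<Sum>j\<in>block_indices q. \<Sum>p\<in>UNIV. complex_of_real (w j / w p) * cinner (\<eta> (u j p)) (\<theta> (u j p)))"
proof (cases "block_indices q = {}")
  case False
  then have q: "q \<in> range w" by auto
  have fibres: "(\<Sum>p\<in>UNIV. f p) = (\<Sum>r\<in>range w. \<Sum>p\<in>block_indices r. f p)" for f :: "'d \<Rightarrow> complex"
    using sum.image_gen[of UNIV f w] by (simp add: block_indices_def)
  have off: "block_pairing \<eta> \<theta> s r = 0" if "s \<in> range w" "r \<in> range w" "s \<noteq> r" for s r
    using that block_pairing_off_diagonal[OF \<eta> \<theta>] by auto
  have "(\<Sum>j\<in>block_indices q. \<Sum>p\<in>UNIV. cinner (\<eta> (u p j)) (\<theta> (u p j)))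
      = (\<Sum>r\<in>range w. block_pairing \<eta> \<theta> r q)"
    unfolding block_pairing_def
    by (subst sum.swap) (simp add: fibres)
  also have "\<dots> = (\<Sum>r\<in>range w. if r = q then block_pairing \<eta> \<theta> q q else 0)"
    using off q by (intro sum.cong) auto
  also have "\<dots> = (\<Sum>r\<in>range w. complex_of_real (q / r) * block_pairing \<eta> \<theta> q r)"
    using off q w_pos by (intro sum.cong) (auto simp: less_imp_neq[symmetric])
  also have "\<dots> = (\<Sum>r\<in>range w. \<Sum>j\<in>block_indices q. \<Sum>p\<in>block_indices r.
      complex_of_real (w j / w p) * cinner (\<eta> (u j p)) (\<theta> (u j p)))"
    unfolding block_pairing_def by (simp add: sum_distrib_left)
  also have "\<dots> = (\<Sum>j\<in>block_indices q. \<Sum>p\<in>UNIV.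
      complex_of_real (w j / w p) * cinner (\<eta> (u j p)) (\<theta> (u j p)))"
    by (subst sum.swap) (simp add: fibres)
  finally show ?thesis .
qed auto

end


section \<open>The universal algebra\<close>

text \<open>Multiplication by a diagonal matrix rescales rows or columns, which turns the matrix
  identities between \<open>u\<close>, \<open>Q\<close> and its inverse into the weighted sums of the locale.\<close>

lemma block_representation_A_u:
  fixes Q :: "complex ^ 'd ^ 'd::finite"
    and \<pi> :: "'d au_term set \<Rightarrow> 'h::complex_hilbert_space \<Rightarrow> 'h"
  assumes diag: "diagonal_matrix Q" and pos: "strictly_positive Q"
    and eps: "distinguished_character Q \<epsilon>" and rep: "Q_representation Q \<pi>"
  shows "block_representation (A_u Q) (\<lambda>j. Re (Q $ j $ j)) (au_gen Q) \<pi> \<epsilon>"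
proof -
  interpret star_algebra "A_u Q" by (rule star_algebra_A_u)
  define w where "w j = Re (Q $ j $ j)" for j
  have w: "w j > 0" and Qw: "Q $ j $ j = complex_of_real (w j)" for j
    using diagonal_entry_pos[OF pos, of j] by (auto simp: w_def)
  have nz: "w j \<noteq> 0" for j using w[of j] by simp
  have Q: "Q $ j $ k = (if j = k then complex_of_real (w j) else 0)" for j k
    using diag Qw by (simp add: diagonal_matrix_def)
  have Qinv: "matrix_inv Q $ j $ k = (if j = k then complex_of_real (1 / w j) else 0)" for j k
    by (subst matrix_inv_diagonal[OF diag]) (auto simp: Qw nz)
  have ucl: "au_gen Q j k \<in> carrier (A_u Q)" "star (A_u Q) (au_gen Q j k) \<in> carrier (A_u Q)" for j k
    by (auto simp: au_gen_closed star_closed)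
  note cl = ucl smult_closed m_closed finsum_closed
  have rels: "amat_mult (A_u Q) (au_gen Q) (amat_adjoint (A_u Q) (au_gen Q)) = amat_one (A_u Q)"
    "amat_mult (A_u Q) (amat_adjoint (A_u Q) (au_gen Q)) (au_gen Q) = amat_one (A_u Q)"
    "amat_mult (A_u Q) (amat_mult (A_u Q) (amat_mult (A_u Q) (amat_transpose (au_gen Q)) (amat_of (A_u Q) Q))
       (amat_bar (A_u Q) (au_gen Q))) (amat_of (A_u Q) (matrix_inv Q)) = amat_one (A_u Q)"
    "amat_mult (A_u Q) (amat_mult (A_u Q) (amat_mult (A_u Q) (amat_of (A_u Q) Q) (amat_bar (A_u Q) (au_gen Q)))
       (amat_of (A_u Q) (matrix_inv Q))) (amat_transpose (au_gen Q)) = amat_one (A_u Q)"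
    using au_relations_A_u[of Q] by (auto simp: au_relations_def)
  have r3: "(\<Oplus>\<^bsub>A_u Q\<^esub>p\<in>UNIV. complex_of_real (w p / w k) \<odot>\<^bsub>A_u Q\<^esub>
      (au_gen Q p j \<otimes>\<^bsub>A_u Q\<^esub> star (A_u Q) (au_gen Q p k))) = amat_one (A_u Q) j k" for j k
  proof -
    have "complex_of_real (1 / w k) \<odot>\<^bsub>A_u Q\<^esub> (\<Oplus>\<^bsub>A_u Q\<^esub>p\<in>UNIV. (complex_of_real (w p) \<odot>\<^bsub>A_u Q\<^esub> au_gen Q p j)
        \<otimes>\<^bsub>A_u Q\<^esub> star (A_u Q) (au_gen Q p k)) = amat_one (A_u Q) j k"
      using rels(3)[THEN fun_cong, THEN fun_cong, of j k]
      apply (subst (asm) diagonal_amat_mult_right[OF star_algebra_A_u Qinv])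
       apply (simp add: amat_mult_def amat_of_def amat_bar_def amat_transpose_def cl)
      apply (subst (asm) diagonal_amat_mult_right[OF star_algebra_A_u Q])
       apply (simp add: amat_transpose_def cl)
      apply (simp add: amat_mult_def amat_bar_def amat_transpose_def)
      done
    then show ?thesis
      by (simp add: smult_finsum cl smult_mult_left smult_assoc[symmetric])
  qed
  have r4: "(\<Oplus>\<^bsub>A_u Q\<^esub>p\<in>UNIV. complex_of_real (w j / w p) \<odot>\<^bsub>A_u Q\<^esub>
      (star (A_u Q) (au_gen Q j p) \<otimes>\<^bsub>A_u Q\<^esub> au_gen Q k p)) = amat_one (A_u Q) j k" for j k
  proof -
    have "(\<Oplus>\<^bsub>A_u Q\<^esub>p\<in>UNIV. (complex_of_real (1 / w p) \<odot>\<^bsub>A_u Q\<^esub> (complex_of_real (w j) \<odot>\<^bsub>A_u Q\<^esub>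
        star (A_u Q) (au_gen Q j p))) \<otimes>\<^bsub>A_u Q\<^esub> au_gen Q k p) = amat_one (A_u Q) j k"
      using rels(4)[THEN fun_cong, THEN fun_cong, of j k]
      apply (subst (asm) diagonal_amat_mult_left[OF star_algebra_A_u Q])
       apply (simp add: amat_bar_def cl)
      apply (subst (asm) diagonal_amat_mult_right[OF star_algebra_A_u Qinv])
       apply (simp add: amat_bar_def cl)
      apply (simp add: amat_mult_def amat_bar_def amat_transpose_def)
      done
    then show ?thesis
      by (simp add: cl smult_mult_left smult_assoc[symmetric])
  qed
  have "star_hom (A_u Q) complex_star_algebra \<epsilon>"
    and e: "\<epsilon> (au_gen Q j k) = (if j = k then 1 else 0)" for j k
    using eps by (auto simp: distinguished_character_def)
  then have eps_values: "\<epsilon> \<one>\<^bsub>A_u Q\<^esub> = 1" "\<epsilon> (star (A_u Q) (au_gen Q j k)) = (if j = k then 1 else 0)"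
    for j k
    using ring_hom_one[of \<epsilon> "A_u Q" complex_star_algebra]
    by (auto simp: star_hom_def complex_star_algebra_def ucl)
  have r1: "(\<Oplus>\<^bsub>A_u Q\<^esub>p\<in>UNIV. au_gen Q j p \<otimes>\<^bsub>A_u Q\<^esub> star (A_u Q) (au_gen Q k p)) = amat_one (A_u Q) j k"
    and r2: "(\<Oplus>\<^bsub>A_u Q\<^esub>p\<in>UNIV. star (A_u Q) (au_gen Q p j) \<otimes>\<^bsub>A_u Q\<^esub> au_gen Q p k) = amat_one (A_u Q) j k"
    for j k
    using rels(1,2)[THEN fun_cong, THEN fun_cong, of j k]
    by (simp_all only: amat_mult_def amat_adjoint_def amat_transpose_def amat_bar_def)
  have "\<pi> (au_gen Q j k) = (\<lambda>_. 0)" if "w j \<noteq> w k" for j k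
    using rep that by (simp add: Q_representation_def Qw)
  then have "block_representation (A_u Q) w (au_gen Q) \<pi> \<epsilon>"
    using rep
    by (intro block_representation.intro star_algebra_A_u block_representation_axioms.intro)
      (simp_all only: w r1 r2 r3 r4 ucl e eps_values Q_representation_def)
  then show ?thesis unfolding w_def .
qed

theorem proposition4p7:
  fixes Q :: "complex ^ 'd ^ 'd::finite"
    and \<pi> :: "'d au_term set \<Rightarrow> 'h::complex_hilbert_space \<Rightarrow> 'h"
    and \<epsilon> :: "'d au_term set \<Rightarrow> complex"
    and \<eta>\<^sub>1 \<eta>\<^sub>2 :: "'d au_term set \<Rightarrow> 'h"
    and c :: "'d au_term set \<Rightarrow> 'd au_term set \<Rightarrow> complex"
  assumes "diagonal_matrix Q" and "strictly_positive Q"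
    and "distinguished_character Q \<epsilon>"
    and "Q_representation Q \<pi>"
    and "\<eta>\<^sub>1 \<in> one_cocycles (A_u Q) \<pi> \<epsilon>" and "\<eta>\<^sub>2 \<in> one_cocycles (A_u Q) \<pi> \<epsilon>"
    and "two_cocycle (A_u Q) \<epsilon> c"
    and "\<And>x y. x \<in> carrier (A_u Q) \<Longrightarrow> y \<in> carrier (A_u Q) \<Longrightarrow>
           c x y = cinner (\<eta>\<^sub>1 (star (A_u Q) x)) (\<eta>\<^sub>2 y)"
  shows "defect Q c \<in> sl_direct_sum Q"
proof -
  interpret block_representation "A_u Q" "\<lambda>j. Re (Q $ j $ j)" "au_gen Q" \<pi> \<epsilon>
    using assms(1-4) by (rule block_representation_A_u)
  have real: "Im (Q $ j $ j) = 0" for j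
    using diagonal_entry_pos[OF assms(2), of j] by auto
  have c: "c (star (A_u Q) (au_gen Q i j)) (au_gen Q k p)
      = cinner (\<eta>\<^sub>1 (au_gen Q i j)) (\<eta>\<^sub>2 (au_gen Q k p))" for i j k p
    by (simp add: assms(8) star_star)
  have "(\<Sum>k\<in>{k. Q $ k $ k = q}. defect Q c $ k $ k) = 0" for q
  proof (cases "\<exists>j. Q $ j $ j = q")
    case True
    then have "{k. Q $ k $ k = q} = block_indices (Re q)"
      using real by (auto simp: block_indices_def complex_eq_iff)
    moreover have "Q $ j $ j / Q $ p $ p = complex_of_real (Re (Q $ j $ j) / Re (Q $ p $ p))" for j p
      using real[of j] real[of p] by (simp add: complex_eq_iff Re_divide Im_divide power2_eq_square)
    ultimately show ?thesis
      using block_trace_eq[OF assms(5,6), of "Re q"]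
      by (simp add: defect_def defect_A_def defect_B_def c sum_subtractf)
  next
    case False
    then have "{k. Q $ k $ k = q} = {}" by simp
    then show ?thesis by simp
  qed
  then show ?thesis by (simp add: sl_direct_sum_def defect_def)
qed

end
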